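(* Let $(G,\sigma)$ be a flow-admissible signed cubic graph. If $(G,\sigma)$ contains no long barbells, then $(G,\sigma)$ admits a nowhere-zero $\mathbb{Z}_4$-flow if and only if $G$ is $3$-edge-colorable.
   Context: A signed graph $(G,\sigma)$ is a graph $G$ with a signature $\sigma:E(G)\to\{-1,+1\}$; edges with $\sigma(e)=-1$ are negative. A circuit is balanced if it contains an even number of negative edges and unbalanced otherwise. A long barbell is the union of two vertex-disjoint unbalanced circuits together with a path meeting the circuits only at its two ends. Each edge $e=uv$ consists of half-edges $h_e^u$ and $h_e^v$; $H(v)$ is the set of half-edges at $v$. An orientation is a map $\tau$ from half-edges to $\{\pm1\}$ with $\tau(h_e^u)\tau(h_e^v)=-\sigma(e)$ for each edge $e=uv$; $\partial(\tau,f)(v)=\sum_{h\in H(v)}\tau(h)f(e_h)$ with $e_h$ the edge containing $h$. A nowhere-zero $\mathbb{Z}_4$-flow is an orientation $\tau$ with $f:E(G)\to\mathbb{Z}_4\setminus\{0\}$ such that $\partial(\tau,f)(v)\equiv 0\pmod 4$ for all $v$. A nowhere-zero $k$-flow is an orientation with $f:E(G)\to\mathbb{Z}$, $1\le|f(e)|\le k-1$, and $\partial(\tau,f)\equiv 0$; $(G,\sigma)$ is flow-admissible if it admits a nowhere-zero $k$-flow for some integer $k$. *)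

theory Defs
  imports Main "HOL-Number_Theory.Cong"
begin

text \<open>
  Finite graphs with loops and parallel edges allowed. An edge e has the two half-edges
  (e, True) and (e, False), and end_of gives the vertex at which a half-edge sits. The choice
  of which half-edge is tagged True carries no meaning. A loop at v has both half-edges at v.
\<close>

type_synonym 'e half_edge = "'e \<times> bool"

record ('v, 'e) mgraph =
  verts :: "'v set"
  edges :: "'e set"
  end_of :: "'e half_edge \<Rightarrow> 'v"

definition multigraph :: "('v, 'e) mgraph \<Rightarrow> bool" where
  "multigraph G \<longleftrightarrow> finite (verts G) \<and> finite (edges G) \<and>
     (\<forall>e\<in>edges G. \<forall>b. end_of G (e, b) \<in> verts G)"

definition ends :: "('v, 'e) mgraph \<Rightarrow> 'e \<Rightarrow> 'v set" where
  "ends G e = {end_of G (e, True), end_of G (e, False)}"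

definition half_edges_at :: "('v, 'e) mgraph \<Rightarrow> 'v \<Rightarrow> 'e half_edge set" where
  "half_edges_at G v = {h. fst h \<in> edges G \<and> end_of G h = v}"

text \<open>The degree of a vertex is its number of half-edges, so a loop counts twice.\<close>

definition cubic :: "('v, 'e) mgraph \<Rightarrow> bool" where
  "cubic G \<longleftrightarrow> (\<forall>v\<in>verts G. card (half_edges_at G v) = 3)"

definition signature :: "('v, 'e) mgraph \<Rightarrow> ('e \<Rightarrow> int) \<Rightarrow> bool" where
  "signature G \<sigma> \<longleftrightarrow> (\<forall>e\<in>edges G. \<sigma> e \<in> {-1, 1})"

definition signed_graph :: "('v, 'e) mgraph \<Rightarrow> ('e \<Rightarrow> int) \<Rightarrow> bool" where
  "signed_graph G \<sigma> \<longleftrightarrow> multigraph G \<and> signature G \<sigma>"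

text \<open>
  A circuit is given by its cyclic sequence of vertices and edges, the i-th edge joining the
  i-th vertex to its successor. A loop is a circuit of length 1, and two parallel edges form
  a circuit of length 2.
\<close>

definition circuit :: "('v, 'e) mgraph \<Rightarrow> 'v list \<Rightarrow> 'e list \<Rightarrow> bool" where
  "circuit G vs es \<longleftrightarrow>
     es \<noteq> [] \<and> length vs = length es \<and> distinct vs \<and> distinct es \<and>
     set vs \<subseteq> verts G \<and> set es \<subseteq> edges G \<and>
     (\<forall>i<length es. ends G (es ! i) = {vs ! i, vs ! (Suc i mod length es)})"

definition unbalanced :: "('e \<Rightarrow> int) \<Rightarrow> 'e list \<Rightarrow> bool" where
  "unbalanced \<sigma> es \<longleftrightarrow> odd (card {e \<in> set es. \<sigma> e = -1})"

definition simple_path :: "('v, 'e) mgraph \<Rightarrow> 'v list \<Rightarrow> 'e list \<Rightarrow> bool" where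
  "simple_path G vs es \<longleftrightarrow>
     length vs = Suc (length es) \<and> distinct vs \<and>
     set vs \<subseteq> verts G \<and> set es \<subseteq> edges G \<and>
     (\<forall>i<length es. ends G (es ! i) = {vs ! i, vs ! Suc i})"

definition has_long_barbell :: "('v, 'e) mgraph \<Rightarrow> ('e \<Rightarrow> int) \<Rightarrow> bool" where
  "has_long_barbell G \<sigma> \<longleftrightarrow>
     (\<exists>us cs ws ds ps qs.
        circuit G us cs \<and> unbalanced \<sigma> cs \<and>
        circuit G ws ds \<and> unbalanced \<sigma> ds \<and>
        set us \<inter> set ws = {} \<and>
        simple_path G ps qs \<and>
        set ps \<inter> set us = {hd ps} \<and> set ps \<inter> set ws = {last ps})"

definition orientation :: "('v, 'e) mgraph \<Rightarrow> ('e \<Rightarrow> int) \<Rightarrow> ('e half_edge \<Rightarrow> int) \<Rightarrow> bool" where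
  "orientation G \<sigma> \<tau> \<longleftrightarrow>
     (\<forall>e\<in>edges G. (\<forall>b. \<tau> (e, b) \<in> {-1, 1}) \<and> \<tau> (e, True) * \<tau> (e, False) = - \<sigma> e)"

definition boundary :: "('v, 'e) mgraph \<Rightarrow> ('e half_edge \<Rightarrow> int) \<Rightarrow> ('e \<Rightarrow> int) \<Rightarrow> 'v \<Rightarrow> int" where
  "boundary G \<tau> f v = (\<Sum>h\<in>half_edges_at G v. \<tau> h * f (fst h))"

definition nowhere_zero_flow ::
  "('v, 'e) mgraph \<Rightarrow> ('e \<Rightarrow> int) \<Rightarrow> int \<Rightarrow> ('e half_edge \<Rightarrow> int) \<Rightarrow> ('e \<Rightarrow> int) \<Rightarrow> bool" where
  "nowhere_zero_flow G \<sigma> k \<tau> f \<longleftrightarrow>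
     orientation G \<sigma> \<tau> \<and>
     (\<forall>e\<in>edges G. 1 \<le> \<bar>f e\<bar> \<and> \<bar>f e\<bar> \<le> k - 1) \<and>
     (\<forall>v\<in>verts G. boundary G \<tau> f v = 0)"

definition flow_admissible :: "('v, 'e) mgraph \<Rightarrow> ('e \<Rightarrow> int) \<Rightarrow> bool" where
  "flow_admissible G \<sigma> \<longleftrightarrow> (\<exists>k \<tau> f. nowhere_zero_flow G \<sigma> k \<tau> f)"

text \<open>
  Elements of the integers modulo m are represented by their residues in {0..<m}, so the
  nonzero ones are those in {1..<m}.
\<close>

definition nowhere_zero_mod_flow ::
  "('v, 'e) mgraph \<Rightarrow> ('e \<Rightarrow> int) \<Rightarrow> int \<Rightarrow> ('e half_edge \<Rightarrow> int) \<Rightarrow> ('e \<Rightarrow> int) \<Rightarrow> bool" where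
  "nowhere_zero_mod_flow G \<sigma> m \<tau> f \<longleftrightarrow>
     orientation G \<sigma> \<tau> \<and>
     (\<forall>e\<in>edges G. f e \<in> {1..<m}) \<and>
     (\<forall>v\<in>verts G. [boundary G \<tau> f v = 0] (mod m))"

definition admits_nowhere_zero_mod_flow :: "('v, 'e) mgraph \<Rightarrow> ('e \<Rightarrow> int) \<Rightarrow> int \<Rightarrow> bool" where
  "admits_nowhere_zero_mod_flow G \<sigma> m \<longleftrightarrow> (\<exists>\<tau> f. nowhere_zero_mod_flow G \<sigma> m \<tau> f)"

text \<open>
  Properness is stated on half-edges: distinct half-edges at a common vertex lie on edges of
  different colours. For loopless graphs this says that distinct edges with a common end have
  different colours; a graph with a loop has no edge colouring, the loop being adjacent to
  itself.
\<close>

definition edge_colorable :: "('v, 'e) mgraph \<Rightarrow> nat \<Rightarrow> bool" where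
  "edge_colorable G k \<longleftrightarrow>
     (\<exists>c :: 'e \<Rightarrow> nat. (\<forall>e\<in>edges G. c e < k) \<and>
        (\<forall>v\<in>verts G. \<forall>h\<in>half_edges_at G v. \<forall>h'\<in>half_edges_at G v.
           h \<noteq> h' \<longrightarrow> c (fst h) \<noteq> c (fst h')))"

end

theory Submission imports Defs begin

text \<open>
  In a nowhere-zero flow modulo 4 the edges of odd value form a 2-factor, and conversely two
  colour classes of a 3-edge-colouring form one. Without long barbells, each component contains
  at most one unbalanced circuit of a 2-factor, hence none if the number of negative edges of the
  2-factor in that component is even.

  Given a flow, counting the boundary shows that for any union of circuits of the 2-factor the
  number of vertices and the number of negative edges have the same parity. A component has evenly
  many vertices, so all circuits are balanced, hence even, and can be coloured alternately; the
  remaining perfect matching gets the third colour.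

  Given a colouring, choose in each component two colour classes with the same parity of negative
  edges. Their circuits are even and balanced, so the vertices carry signs \<open>p\<close> with
  \<open>p(u) p(v) = - \<sigma>(uv)\<close> along them. Directing the half-edges of the 2-factor at \<open>v\<close>
  by \<open>p(v)\<close> gives a flow of value 1 there and 2 on the third colour class.
\<close>

section \<open>Reachability classes of an edge set, double counting and connecting paths\<close>

definition adj :: "('v, 'e) mgraph \<Rightarrow> 'e set \<Rightarrow> ('v \<times> 'v) set" where
  "adj G F = {(u, v). \<exists>e\<in>F. \<exists>b. u = end_of G (e, b) \<and> v = end_of G (e, \<not> b)}"

definition reach :: "('v, 'e) mgraph \<Rightarrow> 'e set \<Rightarrow> 'v \<Rightarrow> 'v set" where
  "reach G F v = (adj G F)\<^sup>* `` {v}"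

text \<open>Testing one end suffices: for \<open>S\<close> closed under \<open>adj G F\<close>, an
  edge of \<open>F\<close> has both ends in \<open>S\<close> or neither
  (\<open>adj_closed_iff\<close>).\<close>

definition edges_in :: "('v, 'e) mgraph \<Rightarrow> 'e set \<Rightarrow> 'v set \<Rightarrow> 'e set" where
  "edges_in G F S = {e \<in> F. end_of G (e, True) \<in> S}"

lemma adjI: "e \<in> F \<Longrightarrow> (end_of G (e, b), end_of G (e, \<not> b)) \<in> adj G F"
  by (auto simp: adj_def)

lemma sym_adj: "sym (adj G F)"
proof (rule symI)
  fix u v assume "(u, v) \<in> adj G F"
  then obtain e b where "e \<in> F" "u = end_of G (e, b)" "v = end_of G (e, \<not> b)"
    by (auto simp: adj_def)
  then show "(v, u) \<in> adj G F" using adjI[of e F G "\<not> b"] by simp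
qed

text \<open>Stated on \<open>UNIV\<close>, so that the class lemmas that follow need no membership
  in \<open>verts G\<close>.\<close>

lemma equiv_reach: "equiv UNIV ((adj G F)\<^sup>*)"
  by (auto intro!: equivI refl_rtrancl trans_rtrancl sym_rtrancl sym_adj)

lemma reach_refl [simp]: "v \<in> reach G F v"
  by (simp add: reach_def)

lemma reach_eq: "u \<in> reach G F v \<Longrightarrow> reach G F u = reach G F v"
  unfolding reach_def by (metis Image_singleton_iff equiv_class_eq equiv_reach)

lemma reach_disjoint: "reach G F u \<noteq> reach G F v \<Longrightarrow> reach G F u \<inter> reach G F v = {}"
  using reach_eq by (metis disjoint_iff)

lemma adj_closed_reach: "adj G F `` reach G F v \<subseteq> reach G F v"
  unfolding reach_def by (auto intro: rtrancl_into_rtrancl)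

lemma reach_least:
  assumes "v \<in> S" "adj G F `` S \<subseteq> S"
  shows "reach G F v \<subseteq> S"
  unfolding reach_def using assms(1) Image_closed_trancl[OF assms(2)] by blast

lemma adj_mono: "F \<subseteq> F' \<Longrightarrow> adj G F \<subseteq> adj G F'"
  by (auto simp: adj_def)

lemma reach_mono: "F \<subseteq> F' \<Longrightarrow> reach G F v \<subseteq> reach G F' v"
  unfolding reach_def using rtrancl_mono[OF adj_mono] by (metis Image_mono subset_refl)

lemma reach_subset_verts:
  assumes "multigraph G" "F \<subseteq> edges G" "v \<in> verts G"
  shows "reach G F v \<subseteq> verts G"
  using assms by (intro reach_least) (auto simp: adj_def multigraph_def)

lemma adj_closed_iff:
  assumes "adj G F `` S \<subseteq> S" "e \<in> F"
  shows "end_of G (e, b) \<in> S \<longleftrightarrow> end_of G (e, True) \<in> S"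
  using assms adjI[of e F G True] adjI[of e F G False] by (cases b) auto

lemma edges_in_reach_iff:
  assumes "e \<in> F"
  shows "end_of G (e, b) \<in> reach G F v \<longleftrightarrow> end_of G (e, True) \<in> reach G F v"
  using adj_closed_iff[OF adj_closed_reach assms] .

lemma reach_end:
  assumes "e \<in> F"
  shows "reach G F (end_of G (e, b)) = reach G F (end_of G (e, True))"
  using edges_in_reach_iff[OF assms, of G b "end_of G (e, True)"] by (intro reach_eq) simp

text \<open>Since \<open>S\<close> is closed, the half-edges of \<open>F\<close> at vertices of
  \<open>S\<close> are exactly both halves of the edges in \<open>edges_in G F S\<close>; the sum is
  regrouped by edges. With \<open>g\<close> constant 1 this counts degrees, with \<open>g\<close> a
  signed flow value it sums boundaries.\<close>

lemma handshake:
  fixes g :: "'e half_edge \<Rightarrow> 'a :: comm_monoid_add"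
  assumes "multigraph G" "F \<subseteq> edges G" "S \<subseteq> verts G" "adj G F `` S \<subseteq> S"
  shows "(\<Sum>v\<in>S. \<Sum>h\<in>{h \<in> half_edges_at G v. fst h \<in> F}. g h)
    = (\<Sum>e\<in>edges_in G F S. g (e, True) + g (e, False))"
proof -
  have fin: "finite F" "finite S"
    using assms finite_subset unfolding multigraph_def by blast+
  have fin_at: "finite {h \<in> half_edges_at G v. fst h \<in> F}" for v
    by (rule finite_subset[of _ "F \<times> UNIV"]) (use fin in \<open>auto simp: mem_Times_iff\<close>)
  have "(\<Sum>v\<in>S. \<Sum>h\<in>{h \<in> half_edges_at G v. fst h \<in> F}. g h)
    = sum g (\<Union>v\<in>S. {h \<in> half_edges_at G v. fst h \<in> F})"
    by (rule sum.UNION_disjoint[symmetric])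
       (use fin fin_at in \<open>auto simp: half_edges_at_def\<close>)
  also have "(\<Union>v\<in>S. {h \<in> half_edges_at G v. fst h \<in> F}) = edges_in G F S \<times> UNIV"
  proof (rule set_eqI)
    fix h :: "'e half_edge"
    obtain e b where h: "h = (e, b)" by (cases h)
    have "e \<in> F \<Longrightarrow> end_of G (e, b) \<in> S \<longleftrightarrow> end_of G (e, True) \<in> S"
      using adj_closed_iff[OF assms(4)] .
    then show "h \<in> (\<Union>v\<in>S. {h \<in> half_edges_at G v. fst h \<in> F}) \<longleftrightarrow> h \<in> edges_in G F S \<times> UNIV"
      using assms(2) by (auto simp: h half_edges_at_def edges_in_def)
  qed
  also have "sum g (edges_in G F S \<times> UNIV) = (\<Sum>e\<in>edges_in G F S. \<Sum>b\<in>UNIV. g (e, b))"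
    by (simp add: sum.cartesian_product)
  finally show ?thesis
    by (simp add: UNIV_bool add.commute)
qed

text \<open>Induction along a walk from \<open>u\<close> to \<open>w\<close>, with \<open>A\<close>
  growing. If the second vertex \<open>u'\<close> lies outside \<open>A\<close> and
  \<open>B\<close>, the induction hypothesis for \<open>insert u' A\<close> gives a path meeting
  that set only at its head. Either this head is already in \<open>A\<close>, or it is
  \<open>u'\<close>; then the path avoids \<open>A\<close> and can be extended by \<open>u\<close>
  in front.\<close>

lemma path_between:
  assumes "multigraph G" "(u, w) \<in> (adj G (edges G))\<^sup>*" "u \<in> A" "w \<in> B" "A \<inter> B = {}"
  shows "\<exists>ps qs. simple_path G ps qs \<and> set ps \<inter> A = {hd ps} \<and> set ps \<inter> B = {last ps}"
  using assms(2,3,5)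
proof (induction arbitrary: A rule: converse_rtrancl_induct)
  case base
  with assms(4) show ?case by blast
next
  case (step u u')
  obtain e where e: "e \<in> edges G" "ends G e = {u, u'}" "u \<in> verts G" "u' \<in> verts G"
  proof -
    obtain e b where "e \<in> edges G" "u = end_of G (e, b)" "u' = end_of G (e, \<not> b)"
      using step.hyps(1) by (auto simp: adj_def)
    then show thesis
      using assms(1) by (intro that[of e]; cases b) (auto simp: ends_def multigraph_def)
  qed
  consider "u' \<in> A" | "u' \<notin> A" "u' \<in> B" | "u' \<notin> A" "u' \<notin> B" by blast
  then show ?case
  proof cases
    case 1
    with step show ?thesis by blast
  next
    case 2
    then have "simple_path G [u, u'] [e]"
      using e step.prems by (auto simp: simple_path_def)
    moreover have "set [u, u'] \<inter> A = {hd [u, u']}" "set [u, u'] \<inter> B = {last [u, u']}"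
      using 2 step.prems by auto
    ultimately show ?thesis by blast
  next
    case 3
    then obtain ps qs where ps: "simple_path G ps qs" "set ps \<inter> insert u' A = {hd ps}"
      "set ps \<inter> B = {last ps}"
      using step.IH[of "insert u' A"] step.prems by blast
    show ?thesis
    proof (cases "hd ps = u'")
      case False
      then have "set ps \<inter> A = {hd ps}" using ps(2) by blast
      with ps show ?thesis by blast
    next
      case True
      have ne: "ps \<noteq> []" using ps(1) by (auto simp: simple_path_def)
      have "set ps \<inter> insert u' A = {u'}" using ps(2) True by simp
      then have disj: "set ps \<inter> A = {}"
        using 3 by (metis IntI disjoint_iff insertI2 singletonD)
      have "simple_path G (u # ps) (e # qs)"
        using ps(1) e disj step.prems True ne
        by (auto simp: simple_path_def nth_Cons hd_conv_nth split: nat.split)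
      moreover have "set (u # ps) \<inter> A = {hd (u # ps)}"
        using disj step.prems by auto
      moreover have "set (u # ps) \<inter> B = {last (u # ps)}"
        using ps(3) step.prems ne by auto
      ultimately show ?thesis by blast
    qed
  qed
qed

section \<open>The classes of a 2-factor are circuits\<close>

locale two_factor =
  fixes G :: "('v, 'e) mgraph" and F :: "'e set"
  assumes mg: "multigraph G"
    and F_sub: "F \<subseteq> edges G"
    and two: "v \<in> verts G \<Longrightarrow> card {h \<in> half_edges_at G v. fst h \<in> F} = 2"
begin

lemma finite_F: "finite F"
  using mg F_sub finite_subset unfolding multigraph_def by blast

lemma end_in_verts: "fst h \<in> F \<Longrightarrow> end_of G h \<in> verts G"
  using mg F_sub unfolding multigraph_def by (metis prod.collapse subsetD)

text \<open>\<open>opp\<close> and \<open>twin\<close> are fixed-point-free involutions on the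
  half-edges of \<open>F\<close>: one crosses the edge, the other switches to the second half-edge
  of \<open>F\<close> at the same vertex. Alternating them traces out a circuit.\<close>

definition opp :: "'e half_edge \<Rightarrow> 'e half_edge" where
  "opp h = (fst h, \<not> snd h)"

definition twin :: "'e half_edge \<Rightarrow> 'e half_edge" where
  "twin h = (THE h'. h' \<noteq> h \<and> fst h' \<in> F \<and> end_of G h' = end_of G h)"

lemma fst_opp [simp]: "fst (opp h) = fst h"
  and opp_opp [simp]: "opp (opp h) = h"
  and opp_neq [simp]: "opp h \<noteq> h"
  by (auto simp: opp_def prod_eq_iff)

lemma twin_ex1:
  assumes "fst h \<in> F"
  shows "\<exists>!h'. h' \<noteq> h \<and> fst h' \<in> F \<and> end_of G h' = end_of G h"
proof -
  let ?X = "{h' \<in> half_edges_at G (end_of G h). fst h' \<in> F}"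
  obtain x y where xy: "?X = {x, y}" "x \<noteq> y"
    using two[OF end_in_verts[OF assms]] by (auto simp: card_2_iff)
  have iff: "h' \<in> ?X \<longleftrightarrow> fst h' \<in> F \<and> end_of G h' = end_of G h" for h'
    using F_sub by (auto simp: half_edges_at_def)
  have "h \<in> ?X" using assms iff by blast
  then have "\<exists>!h'. h' \<noteq> h \<and> h' \<in> ?X" unfolding xy(1) using xy(2) by auto
  then show ?thesis unfolding iff .
qed

lemma
  assumes "fst h \<in> F"
  shows twin_neq: "twin h \<noteq> h" and fst_twin: "fst (twin h) \<in> F"
    and end_twin: "end_of G (twin h) = end_of G h"
  using theI'[OF twin_ex1[OF assms]] unfolding twin_def by auto

lemma twin_unique:
  assumes "fst h \<in> F" "fst h' \<in> F" "end_of G h' = end_of G h" "h' \<noteq> h"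
  shows "h' = twin h"
  using twin_ex1[OF assms(1)] assms twin_neq fst_twin end_twin by metis

lemma twin_twin: "fst h \<in> F \<Longrightarrow> twin (twin h) = h"
  using twin_unique[of "twin h" h] fst_twin end_twin twin_neq by metis

text \<open>\<open>walk h i\<close> is the half-edge by which the \<open>i\<close>-th vertex is
  left: \<open>opp\<close> crosses its edge, and \<open>twin\<close> picks the exit at the next
  vertex.\<close>

definition walk :: "'e half_edge \<Rightarrow> nat \<Rightarrow> 'e half_edge" where
  "walk h i = ((twin \<circ> opp) ^^ i) h"

lemma walk_0 [simp]: "walk h 0 = h"
  and walk_Suc: "walk h (Suc i) = twin (opp (walk h i))"
  by (simp_all add: walk_def)

context
  fixes h :: "'e half_edge"
  assumes h: "fst h \<in> F"
begin

lemma fst_walk: "fst (walk h i) \<in> F"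
  using h by (induction i) (auto simp: walk_Suc fst_twin)

lemma twin_walk_Suc: "twin (walk h (Suc i)) = opp (walk h i)"
  by (simp add: walk_Suc twin_twin fst_walk)

lemma end_walk_Suc: "end_of G (walk h (Suc i)) = end_of G (opp (walk h i))"
  by (simp add: walk_Suc end_twin fst_walk)

lemma walk_Suc_inj: "walk h (Suc i) = walk h (Suc j) \<Longrightarrow> walk h i = walk h j"
  by (metis opp_opp twin_walk_Suc)

lemma walk_add_inj: "walk h (i + k) = walk h (j + k) \<Longrightarrow> walk h i = walk h j"
  by (induction k) (auto dest: walk_Suc_inj)

text \<open>The walk never traverses a vertex in both directions: a coincidence propagates inwards to
  a fixed point of one of the two involutions.\<close>

lemma walk_neq_twin_le: "i \<le> j \<Longrightarrow> walk h i \<noteq> twin (walk h j)"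
proof (induction "j - i" arbitrary: i j rule: less_induct)
  case less
  show ?case
  proof
    assume eq: "walk h i = twin (walk h j)"
    then have "i \<noteq> j" using twin_neq[OF fst_walk] by metis
    then obtain k where k: "j = Suc k" "i \<le> k" using less.prems by (cases j) auto
    have ok: "walk h i = opp (walk h k)" using eq k twin_walk_Suc by simp
    then have "i \<noteq> k" using opp_neq by metis
    then have ik: "Suc i \<le> k" using k by simp
    have "walk h (Suc i) = twin (walk h k)" using ok by (simp add: walk_Suc)
    then show False using less.hyps[of k "Suc i"] ik k by auto
  qed
qed

lemma walk_neq_twin: "walk h i \<noteq> twin (walk h j)"
  using walk_neq_twin_le[of i j] walk_neq_twin_le[of j i] twin_twin[OF fst_walk]
  by (metis nle_le)

text \<open>Finiteness forces a repetition, and invertibility of the steps pulls it back to the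
  start.\<close>

lemma walk_period: "\<exists>n>0. walk h n = h"
proof -
  have "range (walk h) \<subseteq> F \<times> UNIV"
    using fst_walk by (simp add: image_subset_iff mem_Times_iff)
  then have "finite (range (walk h))" by (rule finite_subset) (simp add: finite_F)
  then have "\<not> inj (walk h)" using finite_imageD infinite_UNIV_nat by blast
  then obtain i j where "i < j" "walk h i = walk h j"
    unfolding inj_def by (metis linorder_neqE_nat)
  then have "walk h (j - i) = h" "0 < j - i"
    using walk_add_inj[of 0 i "j - i"] by auto
  then show ?thesis by blast
qed

text \<open>The walk is followed up to its first return to \<open>h\<close>. A vertex visited twice
  would be left by equal or twin half-edges; the first contradicts minimality, the second
  \<open>walk_neq_twin\<close>. Both half-edges of \<open>F\<close> at a visited vertex lie on edges
  of the walk, so the visited set is closed and fills the whole class.\<close>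

lemma circuit_through:
  "\<exists>us cs. circuit G us cs \<and> set us = reach G F (end_of G h)
    \<and> set cs = edges_in G F (reach G F (end_of G h))"
proof -
  define n where "n = (LEAST n. n > 0 \<and> walk h n = h)"
  have n: "n > 0" "walk h n = h"
    using LeastI_ex[OF walk_period] unfolding n_def by auto
  have least: "walk h m \<noteq> h" if "0 < m" "m < n" for m
    using not_less_Least[of m "\<lambda>n. n > 0 \<and> walk h n = h"] that unfolding n_def by auto
  have neq: "walk h i \<noteq> walk h j" if "i < j" "j < n" for i j
    using walk_add_inj[of 0 i "j - i"] least[of "j - i"] that by force
  then have inj: "walk h i = walk h j \<Longrightarrow> i < n \<Longrightarrow> j < n \<Longrightarrow> i = j" for i j
    by (metis linorder_neqE_nat)
  define us where "us = map (\<lambda>i. end_of G (walk h i)) [0..<n]"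
  define cs where "cs = map (\<lambda>i. fst (walk h i)) [0..<n]"
  have len: "length us = n" "length cs = n" by (auto simp: us_def cs_def)
  have set_us: "set us = (\<lambda>i. end_of G (walk h i)) ` {..<n}"
    and set_cs: "set cs = (\<lambda>i. fst (walk h i)) ` {..<n}"
    by (auto simp: us_def cs_def)
  have d_us: "distinct us"
    unfolding us_def distinct_map
    by (auto intro!: inj_onI) (metis fst_walk inj twin_unique walk_neq_twin)
  have "walk h i = walk h j" if "fst (walk h i) = fst (walk h j)" for i j
  proof (rule ccontr)
    assume "walk h i \<noteq> walk h j"
    then have "walk h i = opp (walk h j)" using that by (auto simp: opp_def prod_eq_iff)
    \<comment> \<open>\<open>opp (walk h j)\<close> is \<open>twin (walk h (Suc j))\<close>, so
      crossing an edge backwards is also excluded by \<open>walk_neq_twin\<close>.\<close>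
    then show False using walk_neq_twin twin_walk_Suc by metis
  qed
  then have d_cs: "distinct cs"
    unfolding cs_def distinct_map using inj by (auto intro!: inj_onI)
  have wrap: "walk h (Suc i mod n) = walk h (Suc i)" if "i < n" for i
    using n that by (cases "Suc i = n") auto
  have joins: "ends G (cs ! i) = {us ! i, us ! (Suc i mod length cs)}" if "i < length cs" for i
  proof -
    have "us ! (Suc i mod length cs) = end_of G (walk h (Suc i))"
      using wrap[of i] that n by (simp add: us_def cs_def)
    moreover have "ends G (cs ! i) = {end_of G (walk h i), end_of G (opp (walk h i))}"
      using that by (cases "walk h i"; cases "snd (walk h i)") (auto simp: cs_def ends_def opp_def)
    ultimately show ?thesis using that by (simp add: us_def cs_def end_walk_Suc)
  qed
  have incident: "fst x \<in> set cs \<and> end_of G (opp x) \<in> set us"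
    if x: "fst x \<in> F" "end_of G x \<in> set us" for x
  proof -
    obtain i where i: "i < n" "end_of G x = end_of G (walk h i)"
      using x by (auto simp: set_us)
    consider "x = walk h i" | "x = twin (walk h i)"
      using twin_unique[OF fst_walk x(1) i(2)] by blast
    then show ?thesis
    proof cases
      case 1
      then have "end_of G (opp x) = end_of G (walk h (Suc i mod n))"
        using end_walk_Suc wrap i by simp
      then show ?thesis using 1 i n by (auto simp: set_us set_cs)
    next
      case 2
      \<comment> \<open>The cyclic predecessor of \<open>i\<close>, which is \<open>n - 1\<close>
        for \<open>i = 0\<close> because \<open>walk h n = h\<close>.\<close>
      obtain k where k: "k < n" "walk h i = walk h (Suc k)"
        using i(1) n by (cases i) (auto intro: that[of "n - 1"] that[of "i - 1"])
      then have "x = opp (walk h k)" using 2 twin_walk_Suc by simp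
      then show ?thesis using k by (auto simp: set_us set_cs)
    qed
  qed
  have closed: "adj G F `` set us \<subseteq> set us"
    unfolding adj_def using incident by (fastforce simp: opp_def)
  have "end_of G (walk h i) \<in> reach G F (end_of G h)" for i
  proof (induction i)
    case (Suc i)
    have "(end_of G (walk h i), end_of G (walk h (Suc i))) \<in> adj G F"
      using adjI[OF fst_walk, of G i "snd (walk h i)"] by (simp add: end_walk_Suc opp_def)
    then show ?case using Suc adj_closed_reach[of G F "end_of G h"] by blast
  qed simp
  then have "set us \<subseteq> reach G F (end_of G h)" by (auto simp: set_us)
  moreover have "reach G F (end_of G h) \<subseteq> set us"
    by (rule reach_least[OF _ closed]) (use n in \<open>auto simp: set_us intro: image_eqI[of _ _ 0]\<close>)
  ultimately have us_eq: "set us = reach G F (end_of G h)" by blast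
  have "set cs = edges_in G F (set us)"
  proof
    show "set cs \<subseteq> edges_in G F (set us)"
    proof
      fix e assume "e \<in> set cs"
      then obtain i where i: "i < n" "e = fst (walk h i)" by (auto simp: set_cs)
      have "end_of G (e, snd (walk h i)) \<in> set us" using i by (auto simp: set_us)
      then show "e \<in> edges_in G F (set us)"
        using adj_closed_iff[OF closed, of e "snd (walk h i)"] fst_walk[of i] i(2)
        by (simp add: edges_in_def)
    qed
    show "edges_in G F (set us) \<subseteq> set cs"
    proof
      fix e assume "e \<in> edges_in G F (set us)"
      then show "e \<in> set cs" using incident[of "(e, True)"] by (simp add: edges_in_def)
    qed
  qed
  moreover have "circuit G us cs"
  proof -
    have "cs \<noteq> []" "length us = length cs" using n len by auto
    moreover have "set us \<subseteq> verts G" "set cs \<subseteq> edges G"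
      using F_sub fst_walk end_in_verts[OF fst_walk] by (auto simp: set_us set_cs)
    ultimately show ?thesis unfolding circuit_def using d_us d_cs joins by blast
  qed
  ultimately show ?thesis using us_eq by metis
qed

end

section \<open>Balance, vertex signs and 2-colourings on the circuits\<close>

lemma class_circuit:
  assumes "v \<in> verts G"
  obtains us cs where "circuit G us cs" "set us = reach G F v"
    "set cs = edges_in G F (reach G F v)"
proof -
  have "{h \<in> half_edges_at G v. fst h \<in> F} \<noteq> {}"
    using two[OF assms] by (metis card.empty zero_neq_numeral)
  then obtain h where "fst h \<in> F" "end_of G h = v" by (auto simp: half_edges_at_def)
  then show thesis using circuit_through[of h] that by blast
qed

text \<open>The negative edges of \<open>F\<close> in the component are distributed over the classes
  of \<open>F\<close> inside it. If one class had an odd number, the even total would force a second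
  such class. Both are unbalanced circuits, they are disjoint, and a path in the component joins
  them into a long barbell.\<close>

lemma class_balanced:
  assumes "\<not> has_long_barbell G \<sigma>" "v \<in> verts G"
    and even: "even (card {e \<in> edges_in G F (reach G (edges G) v). \<sigma> e = -1})"
    and u: "u \<in> reach G (edges G) v"
  shows "even (card {e \<in> edges_in G F (reach G F u). \<sigma> e = -1})"
proof (rule ccontr)
  let ?K = "reach G (edges G) v"
  define N where "N D = {e \<in> edges_in G F D. \<sigma> e = -1}" for D
  define \<D> where "\<D> = reach G F ` ?K"
  assume "odd (card {e \<in> edges_in G F (reach G F u). \<sigma> e = -1})"
  then have odd_u: "odd (card (N (reach G F u)))" by (simp add: N_def)
  have K: "?K \<subseteq> verts G" using reach_subset_verts[OF mg _ assms(2)] by simp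
  then have "finite ?K" using mg finite_subset unfolding multigraph_def by blast
  then have fin: "finite \<D>" by (simp add: \<D>_def)
  have fin_N: "finite (N D)" for D
    using finite_F by (simp add: N_def edges_in_def)
  have sub: "reach G F w \<subseteq> ?K" if "w \<in> ?K" for w
    using reach_mono[OF F_sub, of G w] reach_eq[OF that] by simp
  have "N ?K = (\<Union>D\<in>\<D>. N D)"
  proof
    show "N ?K \<subseteq> (\<Union>D\<in>\<D>. N D)"
      by (auto simp: N_def edges_in_def \<D>_def intro: reach_refl)
    show "(\<Union>D\<in>\<D>. N D) \<subseteq> N ?K"
      using sub by (auto simp: N_def edges_in_def \<D>_def)
  qed
  then have "card (N ?K) = card (\<Union>D\<in>\<D>. N D)" by simp
  also have "\<dots> = (\<Sum>D\<in>\<D>. card (N D))"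
  proof (rule card_UN_disjoint[OF fin])
    show "\<forall>D\<in>\<D>. \<forall>D'\<in>\<D>. D \<noteq> D' \<longrightarrow> N D \<inter> N D' = {}"
      using reach_disjoint[of G F] by (fastforce simp: \<D>_def N_def edges_in_def)
  qed (simp add: fin_N)
  also have "\<dots> = card (N (reach G F u)) + (\<Sum>D\<in>\<D> - {reach G F u}. card (N D))"
    using fin u by (intro sum.remove) (auto simp: \<D>_def)
  finally have "odd (\<Sum>D\<in>\<D> - {reach G F u}. card (N D))"
    using even odd_u by (simp add: N_def)
  then have "\<exists>D\<in>\<D> - {reach G F u}. odd (card (N D))"
    by (rule contrapos_np) (auto intro!: dvd_sum)
  then obtain D where D: "D \<in> \<D>" "D \<noteq> reach G F u" "odd (card (N D))" by blast
  then obtain w where w: "w \<in> ?K" "D = reach G F w" by (auto simp: \<D>_def)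
  obtain us cs where cs: "circuit G us cs" "set us = reach G F u"
    "set cs = edges_in G F (reach G F u)"
    using class_circuit u K by (metis subsetD)
  obtain ws ds where ds: "circuit G ws ds" "set ws = D" "set ds = edges_in G F D"
    using class_circuit w K by (metis subsetD)
  have disj: "set us \<inter> set ws = {}"
    using reach_disjoint D(2) cs(2) ds(2) w(2) by metis
  have "(u, w) \<in> (adj G (edges G))\<^sup>*"
    using reach_eq[OF u] w(1) unfolding reach_def by blast
  then obtain ps qs where "simple_path G ps qs" "set ps \<inter> set us = {hd ps}"
      "set ps \<inter> set ws = {last ps}"
    using path_between[OF mg, of u w "set us" "set ws"] disj cs(2) ds(2) w(2) by auto
  moreover have "unbalanced \<sigma> cs" "unbalanced \<sigma> ds"
    using odd_u D(3) by (simp_all add: unbalanced_def cs(3) ds(3) N_def)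
  ultimately have "has_long_barbell G \<sigma>"
    unfolding has_long_barbell_def using cs(1) ds(1) disj by blast
  with assms(1) show False ..
qed

text \<open>Starting from 1, the sign is multiplied by \<open>- \<sigma> e\<close> along each edge
  of the circuit. This closes up because the full product is -1 to the length of the circuit times
  -1 to its number of negative edges, and both exponents are even.\<close>

lemma class_potential:
  fixes \<sigma> :: "'e \<Rightarrow> int"
  assumes "v \<in> verts G" "signature G \<sigma>"
    and even_D: "even (card (reach G F v))"
    and even_neg: "even (card {e \<in> edges_in G F (reach G F v). \<sigma> e = -1})"
  shows "\<exists>p :: 'v \<Rightarrow> int. (\<forall>u\<in>reach G F v. p u \<in> {-1, 1}) \<and>
    (\<forall>e\<in>edges_in G F (reach G F v). p (end_of G (e, True)) * p (end_of G (e, False)) = - \<sigma> e)"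
proof -
  obtain us cs where cs: "circuit G us cs" "set us = reach G F v"
    "set cs = edges_in G F (reach G F v)"
    using class_circuit[OF assms(1)] .
  define n where "n = length cs"
  have n: "n > 0" "length us = n" "distinct us" "distinct cs"
    and joins: "\<And>i. i < n \<Longrightarrow> ends G (cs ! i) = {us ! i, us ! (Suc i mod n)}"
    using cs(1) by (auto simp: circuit_def n_def)
  define w where "w i = - \<sigma> (cs ! i)" for i
  define q where "q i = (\<Prod>j<i. w j)" for i
  define p where "p u = q (inv_into {..<n} ((!) us) u)" for u
  have p_us: "p (us ! i) = q i" if "i < n" for i
    using that n by (simp add: p_def inv_into_f_f inj_on_nth)
  have w: "w i \<in> {-1, 1}" if "i < n" for i
  proof -
    have "cs ! i \<in> edges G" using that cs(1) by (auto simp: circuit_def n_def)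
    then show ?thesis using assms(2) by (auto simp: w_def signature_def)
  qed
  have q: "q i \<in> {-1, 1}" if "i \<le> n" for i
    using that
  proof (induction i)
    case (Suc i)
    then show ?case using w[of i] by (auto simp: q_def)
  qed (simp add: q_def)
  have "q n = (\<Prod>e\<in>set cs. - \<sigma> e)"
    unfolding q_def w_def n_def
    using prod.reindex_bij_betw[OF bij_betw_nth[OF n(4) refl refl], of "\<lambda>e. - \<sigma> e"] by simp
  also have "\<dots> = (\<Prod>e\<in>set cs. -1) * (\<Prod>e\<in>set cs. \<sigma> e)"
    by (simp flip: prod.distrib del: prod_constant)
  \<comment> \<open>The circuit has as many edges as vertices, hence evenly many.\<close>
  also have "(\<Prod>e\<in>set cs. -1) = (1 :: int)"
    using even_D n distinct_card cs(2) by (metis n_def neg_one_even_power prod_constant)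
  also have "(\<Prod>e\<in>set cs. \<sigma> e) = (\<Prod>e\<in>set cs. if \<sigma> e = -1 then -1 else 1)"
  proof (rule prod.cong)
    fix e assume "e \<in> set cs"
    then have "e \<in> edges G" using cs(1) by (auto simp: circuit_def)
    then show "\<sigma> e = (if \<sigma> e = -1 then -1 else 1)"
      using assms(2) by (auto simp: signature_def)
  qed simp
  also have "\<dots> = (\<Prod>e\<in>{e \<in> set cs. \<sigma> e = -1}. -1)"
    by (rule prod.inter_filter[symmetric]) simp
  also have "\<dots> = 1" using even_neg cs(3) by simp
  finally have qn: "q n = 1" by simp
  have "p (end_of G (e, True)) * p (end_of G (e, False)) = - \<sigma> e" if e: "e \<in> set cs" for e
  proof -
    obtain i where i: "i < n" "e = cs ! i" using e by (auto simp: in_set_conv_nth n_def)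
    have "p (end_of G (e, True)) * p (end_of G (e, False)) = p (us ! i) * p (us ! (Suc i mod n))"
      using joins[OF i(1)] i(2) by (auto simp: ends_def doubleton_eq_iff)
    also have "p (us ! (Suc i mod n)) = q (Suc i)"
    \<comment> \<open>The last edge returns to position 0, where the sign is \<open>q 0 = 1\<close>;
      it agrees with \<open>q n\<close> by \<open>qn\<close>.\<close>
    proof (cases "Suc i = n")
      case True
      then show ?thesis using p_us[of 0] n qn by (simp add: q_def)
    next
      case False
      then show ?thesis using p_us[of "Suc i"] i by simp
    qed
    also have "p (us ! i) * q (Suc i) = w i"
      using q[of i] i(1) by (auto simp: p_us q_def)
    finally show ?thesis by (simp add: w_def i)
  qed
  moreover have "p u \<in> {-1, 1}" if u: "u \<in> set us" for u
  proof -
    obtain i where "i < n" "u = us ! i" using u n(2) by (metis in_set_conv_nth)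
    then show ?thesis using p_us q[of i] by simp
  qed
  ultimately show ?thesis using cs by metis
qed

text \<open>Edges are coloured by the parity of their position on the circuit; even length makes the
  last edge differ from the first.\<close>

lemma class_colouring:
  assumes "v \<in> verts G" and even_D: "even (card (reach G F v))"
  shows "\<exists>c :: 'e \<Rightarrow> nat. (\<forall>e. c e < 2) \<and>
    (\<forall>u\<in>reach G F v. \<forall>h\<in>half_edges_at G u. \<forall>h'\<in>half_edges_at G u.
      fst h \<in> F \<longrightarrow> fst h' \<in> F \<longrightarrow> h \<noteq> h' \<longrightarrow> c (fst h) \<noteq> c (fst h'))"
proof -
  obtain us cs where cs: "circuit G us cs" "set us = reach G F v"
    "set cs = edges_in G F (reach G F v)"
    using class_circuit[OF assms(1)] .
  define n where "n = length cs"
  have n: "n > 0" "length us = n" "distinct us" "distinct cs"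
    and joins: "\<And>i. i < n \<Longrightarrow> ends G (cs ! i) = {us ! i, us ! (Suc i mod n)}"
    using cs(1) by (auto simp: circuit_def n_def)
  have even_n: "even n" using even_D n distinct_card cs(2) by metis
  define c where "c e = inv_into {..<n} ((!) cs) e mod 2" for e
  have c_cs: "c (cs ! i) = i mod 2" if "i < n" for i
    using that n by (simp add: c_def n_def inv_into_f_f inj_on_nth)
  have at: "\<exists>b. end_of G (cs ! i, b) = u \<and> (cs ! i, b) \<in> {h \<in> half_edges_at G u. fst h \<in> F}"
    if "i < n" "u \<in> ends G (cs ! i)" for i u
  proof -
    have "cs ! i \<in> F" using that(1) cs(3) nth_mem by (fastforce simp: n_def edges_in_def)
    then show ?thesis using that(2) F_sub by (auto simp: ends_def half_edges_at_def)
  qed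
  have "c (fst h) \<noteq> c (fst h')"
    if u: "u \<in> set us" and hh: "h \<in> half_edges_at G u" "h' \<in> half_edges_at G u"
      "fst h \<in> F" "fst h' \<in> F" "h \<noteq> h'" for u h h'
  proof -
    let ?X = "{h \<in> half_edges_at G u. fst h \<in> F}"
    obtain i where i: "i < n" "u = us ! i" using u n(2) by (metis in_set_conv_nth)
    \<comment> \<open>\<open>j\<close> is the position of the edge entering \<open>u\<close>; for
      \<open>i = 0\<close> it is \<open>n - 1\<close>, odd because \<open>n\<close> is even.\<close>
    obtain j where j: "j < n" "Suc j mod n = i" "j mod 2 \<noteq> i mod 2"
    proof (cases i)
      case 0
      have "(n - 1) mod 2 \<noteq> i mod 2" using 0 n(1) even_n by presburger
      then show ?thesis using 0 n(1) by (intro that[of "n - 1"]) auto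
    next
      case (Suc k)
      have "k mod 2 \<noteq> i mod 2" using Suc by presburger
      then show ?thesis using Suc i by (intro that[of k]) auto
    qed
    obtain b b' where b: "(cs ! i, b) \<in> ?X" "(cs ! j, b') \<in> ?X"
      using at[OF i(1), of u] at[OF j(1), of u] joins[OF i(1)] joins[OF j(1)] i(2) j(2) by auto
    have ne: "(cs ! i, b) \<noteq> (cs ! j, b')" using c_cs[OF i(1)] c_cs[OF j(1)] j(3) by auto
    have card_X: "card ?X = 2" using two u cs(1) by (auto simp: circuit_def)
    then have "finite ?X" by (intro card_ge_0_finite) simp
    \<comment> \<open>Exactly two half-edges of \<open>F\<close> sit at \<open>u\<close>, so these
      two are all of them.\<close>
    then have "{(cs ! i, b), (cs ! j, b')} = ?X"
      using b ne card_X by (intro card_subset_eq) auto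
    moreover have "h \<in> ?X" "h' \<in> ?X" using hh by auto
    ultimately have "h \<in> {(cs ! i, b), (cs ! j, b')}" "h' \<in> {(cs ! i, b), (cs ! j, b')}"
      by simp_all
    then show ?thesis using c_cs[OF i(1)] c_cs[OF j(1)] j(3) hh(5) by auto
  qed
  then show ?thesis using cs(2) by (intro exI[of _ c]) (auto simp: c_def)
qed

text \<open>Count the boundary over \<^term>\<open>S\<close> modulo 4: each vertex contributes 2, and so does each
  negative edge, while positive edges cancel.\<close>

lemma parity_negative_edges:
  fixes \<sigma> :: "'e \<Rightarrow> int"
  assumes "signature G \<sigma>" "orientation G \<sigma> \<tau>" "S \<subseteq> verts G" "adj G F `` S \<subseteq> S"
    and odd: "\<And>e. e \<in> F \<Longrightarrow> odd (f e)"
    and sum_2: "\<And>v. v \<in> verts G \<Longrightarrow>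
      [(\<Sum>h\<in>{h \<in> half_edges_at G v. fst h \<in> F}. \<tau> h * f (fst h)) = 2] (mod 4)"
  shows "even (card S) \<longleftrightarrow> even (card {e \<in> edges_in G F S. \<sigma> e = -1})"
proof -
  let ?N = "{e \<in> edges_in G F S. \<sigma> e = -1}"
  have fin: "finite (edges_in G F S)" using finite_F by (simp add: edges_in_def)
  have "[(\<Sum>v\<in>S. \<Sum>h\<in>{h \<in> half_edges_at G v. fst h \<in> F}. \<tau> h * f (fst h)) = (\<Sum>v\<in>S. 2)] (mod 4)"
    using sum_2 assms(3) by (intro cong_sum) auto
  moreover have "[(\<Sum>e\<in>edges_in G F S. \<tau> (e, True) * f e + \<tau> (e, False) * f e)
      = (\<Sum>e\<in>edges_in G F S. if \<sigma> e = -1 then 2 else 0)] (mod 4)"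
  proof (rule cong_sum)
    fix e assume "e \<in> edges_in G F S"
    then have e: "e \<in> F" "e \<in> edges G" using F_sub by (auto simp: edges_in_def)
    have "\<tau> (e, True) \<in> {-1, 1}" "\<tau> (e, False) \<in> {-1, 1}" "\<sigma> e \<in> {-1, 1}"
      "\<tau> (e, True) * \<tau> (e, False) = - \<sigma> e"
      using assms(1,2) e(2) by (auto simp: orientation_def signature_def)
    \<comment> \<open>The two orientation signs agree on a negative edge, giving plus or minus twice
      an odd number: 2 modulo 4 either way.\<close>
    moreover have "(f e + f e) mod 4 = 2" "(- f e - f e) mod 4 = 2"
      using odd[OF e(1)] by presburger+
    ultimately show "[\<tau> (e, True) * f e + \<tau> (e, False) * f e = (if \<sigma> e = -1 then 2 else 0)] (mod 4)"
      by (auto simp: cong_def)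
  qed
  moreover have "(\<Sum>e\<in>edges_in G F S. if \<sigma> e = -1 then 2 else 0) = (\<Sum>e\<in>?N. 2 :: int)"
    by (rule sum.inter_filter[OF fin, symmetric])
  ultimately have "[2 * int (card S) = 2 * int (card ?N)] (mod 4)"
    using handshake[OF mg F_sub assms(3,4), of "\<lambda>h. \<tau> h * f (fst h)"]
    by (simp add: cong_def mult.commute)
  then show ?thesis unfolding cong_def by presburger
qed

end

section \<open>Degree counts, and from a flow modulo 4 to a colouring\<close>

text \<open>Used with \<open>d = 3\<close> for components of the cubic graph and with
  \<open>d = 1\<close> for a colour class matching all vertices of a circuit.\<close>

lemma regular_handshake:
  assumes "multigraph G" "F \<subseteq> edges G" "S \<subseteq> verts G" "adj G F `` S \<subseteq> S"
    and "\<And>v. v \<in> S \<Longrightarrow> card {h \<in> half_edges_at G v. fst h \<in> F} = d"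
  shows "d * card S = 2 * card (edges_in G F S)"
  using handshake[OF assms(1-4), of "\<lambda>_. 1 :: nat"] assms(5)
  by (simp add: mult.commute mult_2)

lemma even_card_component:
  assumes "multigraph G" "cubic G" "v \<in> verts G"
  shows "even (card (reach G (edges G) v))"
proof -
  let ?K = "reach G (edges G) v"
  have K: "?K \<subseteq> verts G" using reach_subset_verts[OF assms(1) _ assms(3)] by simp
  have "{h \<in> half_edges_at G u. fst h \<in> edges G} = half_edges_at G u" for u
    by (auto simp: half_edges_at_def)
  then have "3 * card ?K = 2 * card (edges_in G (edges G) ?K)"
    using assms(2) K by (intro regular_handshake[OF assms(1) _ K adj_closed_reach]) (auto simp: cubic_def)
  then show ?thesis by presburger
qed

text \<open>For the three half-edges at a vertex. The sum is even, so zero or two values are odd.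
  With none odd, all three would be 2 modulo 4 and add up to 2 rather than 0. So two are odd, and
  they compensate a third value congruent to 2.\<close>

lemma odd_part_of_mod_4_sum:
  fixes g :: "'a \<Rightarrow> int"
  assumes "card A = 3" "[(\<Sum>h\<in>A. g h) = 0] (mod 4)" "\<And>h. h \<in> A \<Longrightarrow> \<not> 4 dvd g h"
  shows "card {h \<in> A. odd (g h)} = 2" "[(\<Sum>h\<in>{h \<in> A. odd (g h)}. g h) = 2] (mod 4)"
proof -
  obtain x y z where A: "A = {x, y, z}" and d: "x \<noteq> y" "x \<noteq> z" "y \<noteq> z"
    using assms(1) by (auto simp: card_3_iff)
  have s: "(g x + g y + g z) mod 4 = 0"
    using assms(2) d by (simp add: A cong_def add.assoc)
  have nd: "\<not> 4 dvd g x" "\<not> 4 dvd g y" "\<not> 4 dvd g z" using assms(3) A by auto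
  have res: "card {h \<in> A. odd (g h)} = 2 \<and> [(\<Sum>h\<in>{h \<in> A. odd (g h)}. g h) = 2] (mod 4)"
    if "{h \<in> A. odd (g h)} = {a, b}" "a \<noteq> b" "(g a + g b) mod 4 = 2" for a b
    using that by (simp add: cong_def)
  have "even (g x) \<and> odd (g y) \<and> odd (g z) \<or> odd (g x) \<and> even (g y) \<and> odd (g z)
    \<or> odd (g x) \<and> odd (g y) \<and> even (g z)"
    using s nd by presburger
  then consider "even (g x)" "odd (g y)" "odd (g z)" | "odd (g x)" "even (g y)" "odd (g z)"
    | "odd (g x)" "odd (g y)" "even (g z)"
    by blast
  then have "card {h \<in> A. odd (g h)} = 2 \<and> [(\<Sum>h\<in>{h \<in> A. odd (g h)}. g h) = 2] (mod 4)"
  proof cases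
    case 1
    moreover have "(g y + g z) mod 4 = 2" using 1 s nd by presburger
    ultimately show ?thesis using d by (intro res[of y z]) (auto simp: A)
  next
    case 2
    moreover have "(g x + g z) mod 4 = 2" using 2 s nd by presburger
    ultimately show ?thesis using d by (intro res[of x z]) (auto simp: A)
  next
    case 3
    moreover have "(g x + g y) mod 4 = 2" using 3 s nd by presburger
    ultimately show ?thesis using d by (intro res[of x y]) (auto simp: A)
  qed
  then show "card {h \<in> A. odd (g h)} = 2" "[(\<Sum>h\<in>{h \<in> A. odd (g h)}. g h) = 2] (mod 4)"
    by auto
qed

lemma colorable_if_mod_4_flow:
  assumes "signed_graph G \<sigma>" "cubic G" "\<not> has_long_barbell G \<sigma>"
    and "admits_nowhere_zero_mod_flow G \<sigma> 4"
  shows "edge_colorable G 3"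
proof -
  have mg: "multigraph G" and sg: "signature G \<sigma>"
    using assms(1) by (auto simp: signed_graph_def)
  obtain \<tau> f where orient: "orientation G \<sigma> \<tau>"
    and f: "\<And>e. e \<in> edges G \<Longrightarrow> f e \<in> {1..<4}"
    and bd: "\<And>v. v \<in> verts G \<Longrightarrow> [boundary G \<tau> f v = 0] (mod 4)"
    using assms(4) unfolding admits_nowhere_zero_mod_flow_def nowhere_zero_mod_flow_def by blast
  define F where "F = {e \<in> edges G. odd (f e)}"
  define g where "g h = \<tau> h * f (fst h)" for h
  have \<tau>: "\<tau> h = 1 \<or> \<tau> h = -1" if "fst h \<in> edges G" for h
    using orient that by (cases h) (auto simp: orientation_def)
  have F_half: "{h \<in> half_edges_at G v. fst h \<in> F} = {h \<in> half_edges_at G v. odd (g h)}" for v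
  proof (intro Collect_cong conj_cong refl)
    fix h assume "h \<in> half_edges_at G v"
    then have "fst h \<in> edges G" by (simp add: half_edges_at_def)
    then show "fst h \<in> F \<longleftrightarrow> odd (g h)" using \<tau>[of h] by (auto simp: F_def g_def)
  qed
  have nd: "\<not> 4 dvd g h" if "h \<in> half_edges_at G v" for h v
  proof -
    have e: "fst h \<in> edges G" using that by (simp add: half_edges_at_def)
    have "\<not> 4 dvd f (fst h)" using f[OF e] zdvd_not_zless[of "f (fst h)" 4] by auto
    then show ?thesis using \<tau>[OF e] by (auto simp: g_def)
  qed
  have F_two: "card {h \<in> half_edges_at G v. fst h \<in> F} = 2"
    and sum_2: "[(\<Sum>h\<in>{h \<in> half_edges_at G v. fst h \<in> F}. g h) = 2] (mod 4)"
    if "v \<in> verts G" for v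
    using odd_part_of_mod_4_sum[of "half_edges_at G v" g] assms(2) bd[OF that] nd that
    unfolding F_half by (auto simp: cubic_def boundary_def g_def)
  interpret two_factor G F
    by unfold_locales (use mg F_two in \<open>auto simp: F_def\<close>)
  have par: "even (card S) \<longleftrightarrow> even (card {e \<in> edges_in G F S. \<sigma> e = -1})"
    if "S \<subseteq> verts G" "adj G F `` S \<subseteq> S" for S
    using parity_negative_edges[OF sg orient that, of f] sum_2 by (auto simp: F_def g_def)
  \<comment> \<open>\<open>par\<close> is used in both directions: on the component it makes the
    number of negative edges in \<open>F\<close> even, \<open>class_balanced\<close> passes this to
    the single circuit, and there \<open>par\<close> turns it into an even number of
    vertices.\<close>
  have even_class: "even (card (reach G F v))" if v: "v \<in> verts G" for v
  proof -
    let ?K = "reach G (edges G) v"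
    have "adj G F `` ?K \<subseteq> ?K"
      using adj_closed_reach[of G "edges G" v] adj_mono[OF F_sub, of G] by blast
    then have "even (card {e \<in> edges_in G F ?K. \<sigma> e = -1})"
      using par[of ?K] even_card_component[OF mg assms(2) v] reach_subset_verts[OF mg _ v] by simp
    then have "even (card {e \<in> edges_in G F (reach G F v). \<sigma> e = -1})"
      using class_balanced[OF assms(3) v] by simp
    then show ?thesis
      using par[OF reach_subset_verts[OF mg F_sub v] adj_closed_reach] by simp
  qed
  \<comment> \<open>The choice is indexed by the class as a set, so all vertices of one circuit
    share the same colouring.\<close>
  have "\<forall>D\<in>reach G F ` verts G. \<exists>c :: 'b \<Rightarrow> nat. (\<forall>e. c e < 2) \<and>
    (\<forall>u\<in>D. \<forall>h\<in>half_edges_at G u. \<forall>h'\<in>half_edges_at G u.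
      fst h \<in> F \<longrightarrow> fst h' \<in> F \<longrightarrow> h \<noteq> h' \<longrightarrow> c (fst h) \<noteq> c (fst h'))"
    using class_colouring even_class by simp
  then obtain C :: "'a set \<Rightarrow> 'b \<Rightarrow> nat" where C2: "\<And>v e. v \<in> verts G \<Longrightarrow> C (reach G F v) e < 2"
    and C: "\<And>v h h'. v \<in> verts G \<Longrightarrow> h \<in> half_edges_at G v \<Longrightarrow> h' \<in> half_edges_at G v \<Longrightarrow>
      fst h \<in> F \<Longrightarrow> fst h' \<in> F \<Longrightarrow> h \<noteq> h' \<Longrightarrow> C (reach G F v) (fst h) \<noteq> C (reach G F v) (fst h')"
    by (metis (no_types, lifting) imageI reach_refl)
  define c where "c e = (if e \<in> F then C (reach G F (end_of G (e, True))) e else 2)" for e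
  have c_F: "c (fst h) = C (reach G F v) (fst h)" if "h \<in> half_edges_at G v" "fst h \<in> F" for h v
    using that reach_end[of "fst h" F G "snd h"] by (simp add: c_def half_edges_at_def)
  have c_lt: "c e < 2" if "e \<in> F" for e
    using C2[OF end_in_verts[of "(e, True)"]] that by (simp add: c_def)
  have c_le: "c e < 3" for e using c_lt[of e] by (cases "e \<in> F") (auto simp: c_def)
  have "c (fst h) \<noteq> c (fst h')"
    if v: "v \<in> verts G" and hh: "h \<in> half_edges_at G v" "h' \<in> half_edges_at G v" "h \<noteq> h'" for v h h'
  proof -
    let ?H = "half_edges_at G v" and ?X = "{h \<in> half_edges_at G v. fst h \<in> F}"
    have H3: "card ?H = 3" using assms(2) v by (simp add: cubic_def)
    then have "finite ?H" by (intro card_ge_0_finite) simp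
    \<comment> \<open>Only one half-edge at \<open>v\<close> lies outside \<open>F\<close>, so
      colour 2 cannot clash with itself.\<close>
    then have "card (?H - ?X) = 1" using H3 F_two[OF v] by (subst card_Diff_subset) auto
    then obtain z where "?H - ?X = {z}" by (auto simp: card_1_singleton_iff)
    then have "\<not> (h \<in> ?H - ?X \<and> h' \<in> ?H - ?X)" using hh(3) by (metis singletonD)
    then consider "fst h \<in> F" "fst h' \<in> F" | "fst h \<in> F" "fst h' \<notin> F" | "fst h \<notin> F" "fst h' \<in> F"
      using hh by blast
    then show ?thesis
    proof cases
      case 1
      then show ?thesis using C[OF v hh(1,2)] c_F hh by simp
    next
      case 2
      then show ?thesis using c_lt[of "fst h"] by (simp add: c_def[of "fst h'"])
    next
      case 3
      then show ?thesis using c_lt[of "fst h'"] by (simp add: c_def[of "fst h"])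
    qed
  qed
  then show ?thesis unfolding edge_colorable_def using c_le by blast
qed

section \<open>From a colouring to a flow modulo 4\<close>

text \<open>By pigeonhole, two of the three colour classes have sizes of equal parity.\<close>

lemma colour_class_parity:
  fixes c :: "'e \<Rightarrow> nat"
  assumes "finite A" "\<And>e. e \<in> A \<Longrightarrow> c e < 3"
  shows "\<exists>m<3. even (card {e \<in> A. c e \<noteq> m})"
proof -
  define N where "N k = card {e \<in> A. c e = k}" for k
  have add: "card {e \<in> A. c e \<noteq> m} = N k + N l"
    if "{k, l, m} = {0, 1, 2}" "k \<noteq> l" "k \<noteq> m" "l \<noteq> m" for k l m
  proof -
    have "c e \<in> {k, l, m}" if "e \<in> A" for e using assms(2)[OF that] \<open>{k, l, m} = _\<close> by auto
    then have "{e \<in> A. c e \<noteq> m} = {e \<in> A. c e = k} \<union> {e \<in> A. c e = l}"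
      using that by auto
    then show ?thesis using assms(1) that(2) unfolding N_def
      by (simp, subst card_Un_disjoint) auto
  qed
  have "card {e \<in> A. c e \<noteq> 0} = N 1 + N 2" "card {e \<in> A. c e \<noteq> 1} = N 0 + N 2"
    "card {e \<in> A. c e \<noteq> 2} = N 0 + N 1"
    by (rule add; auto)+
  moreover have "even (N 1 + N 2) \<or> even (N 0 + N 2) \<or> even (N 0 + N 1)" by auto
  ultimately have "\<exists>m\<in>{0, 1, 2}. even (card {e \<in> A. c e \<noteq> m})" by simp
  then show ?thesis by (elim bexE) (auto intro: exI[of _ "0::nat"] exI[of _ "1::nat"] exI[of _ "2::nat"])
qed

lemma mod_4_flow_if_colorable:
  assumes "signed_graph G \<sigma>" "cubic G" "\<not> has_long_barbell G \<sigma>" "edge_colorable G 3"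
  shows "admits_nowhere_zero_mod_flow G \<sigma> 4"
proof -
  have mg: "multigraph G" and sg: "signature G \<sigma>"
    using assms(1) by (auto simp: signed_graph_def)
  obtain c :: "'b \<Rightarrow> nat" where c3: "\<And>e. e \<in> edges G \<Longrightarrow> c e < 3"
    and proper: "\<And>v h h'. v \<in> verts G \<Longrightarrow> h \<in> half_edges_at G v \<Longrightarrow> h' \<in> half_edges_at G v \<Longrightarrow>
      h \<noteq> h' \<Longrightarrow> c (fst h) \<noteq> c (fst h')"
    using assms(4) unfolding edge_colorable_def by blast
  have H3: "card (half_edges_at G v) = 3" and fin_H: "finite (half_edges_at G v)"
    if "v \<in> verts G" for v
    using assms(2) that card_ge_0_finite[of "half_edges_at G v"] by (auto simp: cubic_def)
  \<comment> \<open>The colours embed the three half-edges at \<open>v\<close> into three colours,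
    so each colour occurs exactly once.\<close>
  have one: "card {h \<in> half_edges_at G v. c (fst h) = k} = 1" if v: "v \<in> verts G" and "k < 3" for v k
  proof -
    let ?H = "half_edges_at G v"
    have inj: "inj_on (\<lambda>h. c (fst h)) ?H" using proper[OF v] by (meson inj_onI)
    have "(\<lambda>h. c (fst h)) ` ?H \<subseteq> {..<3}" using c3 by (auto simp: half_edges_at_def)
    then have "(\<lambda>h. c (fst h)) ` ?H = {..<3}"
      using card_image[OF inj] H3[OF v] by (intro card_subset_eq) auto
    then have "k \<in> (\<lambda>h. c (fst h)) ` ?H" using \<open>k < 3\<close> by simp
    then obtain x where x: "x \<in> ?H" "c (fst x) = k" by blast
    have "y = x" if y: "y \<in> ?H" "c (fst y) = k" for y
    proof (rule ccontr)
      assume "y \<noteq> x"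
      from proper[OF v y(1) x(1) this] y(2) x(2) show False by simp
    qed
    then have "{h \<in> ?H. c (fst h) = k} = {x}" using x by blast
    then show ?thesis by simp
  qed
  have "\<exists>m<3. even (card {e \<in> {e \<in> edges_in G (edges G) K. \<sigma> e = -1}. c e \<noteq> m})" for K
  proof (rule colour_class_parity)
    show "finite {e \<in> edges_in G (edges G) K. \<sigma> e = -1}"
      using mg by (simp add: edges_in_def multigraph_def)
  qed (use c3 in \<open>auto simp: edges_in_def\<close>)
  then have "\<forall>K. \<exists>m<3. even (card {e \<in> {e \<in> edges_in G (edges G) K. \<sigma> e = -1}. c e \<noteq> m})"
    by blast
  \<comment> \<open>\<open>m K\<close> is the colour left out of the 2-factor on \<open>K\<close>;
    it is chosen for every set but only evaluated at components.\<close>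
  from choice[OF this] obtain m where m3: "\<And>K. m K < (3 :: nat)"
    and m: "\<And>K. even (card {e \<in> {e \<in> edges_in G (edges G) K. \<sigma> e = -1}. c e \<noteq> m K})"
    by blast
  define K where "K v = reach G (edges G) v" for v
  define F where "F = {e \<in> edges G. c e \<noteq> m (K (end_of G (e, True)))}"
  have F_half: "fst h \<in> F \<longleftrightarrow> c (fst h) \<noteq> m (K v)" if "h \<in> half_edges_at G v" for h v
    using that reach_end[of "fst h" "edges G" G "snd h"]
    by (simp add: F_def K_def half_edges_at_def)
  have compl: "half_edges_at G v - {h \<in> half_edges_at G v. fst h \<in> F}
      = {h \<in> half_edges_at G v. c (fst h) = m (K v)}" for v
    using F_half by auto
  have F_two: "card {h \<in> half_edges_at G v. fst h \<in> F} = 2" if "v \<in> verts G" for v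
  proof -
    have "{h \<in> half_edges_at G v. fst h \<in> F}
        = half_edges_at G v - {h \<in> half_edges_at G v. c (fst h) = m (K v)}"
      using F_half by auto
    then show ?thesis
      using H3[OF that] fin_H[OF that] one[OF that m3] by (simp, subst card_Diff_subset) auto
  qed
  interpret two_factor G F
    by unfold_locales (use mg F_two in \<open>auto simp: F_def\<close>)
  \<comment> \<open>The omitted colour is constant on a component, so the choice of \<open>m\<close>
    is exactly the parity that \<open>class_balanced\<close> asks for.\<close>
  have balanced: "even (card {e \<in> edges_in G F (reach G F v). \<sigma> e = -1})"
    if v: "v \<in> verts G" for v
  proof -
    have "m (K (end_of G (e, True))) = m (K v)" if "end_of G (e, True) \<in> K v" for e
      using reach_eq that unfolding K_def by metis
    then have "{e \<in> edges_in G F (K v). \<sigma> e = -1}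
        = {e \<in> {e \<in> edges_in G (edges G) (K v). \<sigma> e = -1}. c e \<noteq> m (K v)}"
      by (auto simp: edges_in_def F_def)
    then show ?thesis using class_balanced[OF assms(3) v] m[of "K v"] by (simp add: K_def)
  qed
  have even_class: "even (card (reach G F v))" if v: "v \<in> verts G" for v
  proof -
    let ?D = "reach G F v"
    \<comment> \<open>A colour kept in this component. Its edges match the vertices of the circuit
      in pairs, so their number is even.\<close>
    obtain a where a: "a < 3" "a \<noteq> m (K v)"
      using that[of 0] that[of 1] by (cases "m (K v) = 0") auto
    have D: "?D \<subseteq> verts G" using reach_subset_verts[OF mg F_sub v] .
    have D_K: "K u = K v" if "u \<in> ?D" for u
      using reach_mono[OF F_sub, of G v] reach_eq[of u G "edges G" v] that unfolding K_def by blast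
    have "1 * card ?D = 2 * card (edges_in G {e \<in> F. c e = a} ?D)"
    proof (rule regular_handshake[OF mg _ D])
      show "{e \<in> F. c e = a} \<subseteq> edges G" using F_sub by auto
      show "adj G {e \<in> F. c e = a} `` ?D \<subseteq> ?D"
        using adj_closed_reach[of G F v] adj_mono[of "{e \<in> F. c e = a}" F G] by blast
      fix u assume u: "u \<in> ?D"
      have "{h \<in> half_edges_at G u. fst h \<in> {e \<in> F. c e = a}}
          = {h \<in> half_edges_at G u. c (fst h) = a}"
        using F_half[of _ u] D_K[OF u] a by auto
      then show "card {h \<in> half_edges_at G u. fst h \<in> {e \<in> F. c e = a}} = 1"
        using one[OF _ a(1)] u D by auto
    qed
    then show ?thesis by presburger
  qed
  have "\<forall>D\<in>reach G F ` verts G. \<exists>p :: 'a \<Rightarrow> int. (\<forall>u\<in>D. p u \<in> {-1, 1}) \<and>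
    (\<forall>e\<in>edges_in G F D. p (end_of G (e, True)) * p (end_of G (e, False)) = - \<sigma> e)"
    using class_potential[OF _ sg] even_class balanced by simp
  then obtain P :: "'a set \<Rightarrow> 'a \<Rightarrow> int"
    where P: "\<And>v. v \<in> verts G \<Longrightarrow> P (reach G F v) v \<in> {-1, 1}"
    and P_edge: "\<And>v e. v \<in> verts G \<Longrightarrow> e \<in> edges_in G F (reach G F v) \<Longrightarrow>
      P (reach G F v) (end_of G (e, True)) * P (reach G F v) (end_of G (e, False)) = - \<sigma> e"
    by (metis (no_types, lifting) imageI reach_refl)
  define p where "p v = P (reach G F v) v" for v
  \<comment> \<open>Off \<open>F\<close> the signs 1 and \<open>- \<sigma> e\<close> are one
    arbitrary admissible choice, since the value 2 equals its negative modulo 4.\<close>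
  define \<tau> where "\<tau> h = (if fst h \<in> F then p (end_of G h) else if snd h then 1 else - \<sigma> (fst h))" for h
  define f :: "'b \<Rightarrow> int" where "f e = (if e \<in> F then 1 else 2)" for e
  have \<sigma>: "\<sigma> e \<in> {-1, 1}" if "e \<in> edges G" for e
    using sg that by (simp add: signature_def)
  have p_edge: "p (end_of G (e, True)) * p (end_of G (e, False)) = - \<sigma> e" if "e \<in> F" for e
    using P_edge[OF end_in_verts[of "(e, True)"], of e] reach_end[OF that, of G False] that
    by (simp add: p_def edges_in_def)
  have p: "p (end_of G h) \<in> {-1, 1}" if "fst h \<in> F" for h
    using P[OF end_in_verts[OF that]] by (simp add: p_def)
  have \<tau>: "\<tau> h \<in> {-1, 1}" if "fst h \<in> edges G" for h
    using \<sigma>[OF that] p[of h] by (auto simp: \<tau>_def)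
  have "orientation G \<sigma> \<tau>"
    unfolding orientation_def
  proof (intro ballI conjI allI)
    fix e assume "e \<in> edges G"
    then show "\<tau> (e, b) \<in> {-1, 1}" for b using \<tau> by simp
    show "\<tau> (e, True) * \<tau> (e, False) = - \<sigma> e" using p_edge by (simp add: \<tau>_def)
  qed
  moreover have "[boundary G \<tau> f v = 0] (mod 4)" if v: "v \<in> verts G" for v
  proof -
    let ?H = "half_edges_at G v" and ?X = "{h \<in> half_edges_at G v. fst h \<in> F}"
    have "card (?H - ?X) = 1" using one[OF v m3] by (simp only: compl)
    then obtain z where z: "?H - ?X = {z}" by (rule card_1_singletonE)
    then have zH: "fst z \<in> edges G" "fst z \<notin> F" by (auto simp: half_edges_at_def)
    have "boundary G \<tau> f v = (\<Sum>h\<in>?H - ?X. \<tau> h * f (fst h)) + (\<Sum>h\<in>?X. \<tau> h * f (fst h))"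
      unfolding boundary_def by (rule sum.subset_diff) (use fin_H[OF v] in auto)
    also have "(\<Sum>h\<in>?X. \<tau> h * f (fst h)) = (\<Sum>h\<in>?X. p v)"
      by (rule sum.cong) (auto simp: \<tau>_def f_def half_edges_at_def)
    also have "\<dots> = 2 * p v" using F_two[OF v] by simp
    also have "(\<Sum>h\<in>?H - ?X. \<tau> h * f (fst h)) = 2 * \<tau> z"
      using zH by (simp add: z f_def)
    \<comment> \<open>Both terms are 2 or -2, and any two such numbers add up to 0 modulo 4.\<close>
    finally show ?thesis
      using \<tau>[OF zH(1)] P[OF v] by (auto simp: p_def cong_def)
  qed
  moreover have "f e \<in> {1..<4}" for e by (simp add: f_def)
  ultimately show ?thesis
    unfolding admits_nowhere_zero_mod_flow_def nowhere_zero_mod_flow_def by blast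
qed

theorem theorem3p13:
  fixes G :: "('v, 'e) mgraph" and \<sigma> :: "'e \<Rightarrow> int"
  assumes "signed_graph G \<sigma>"
    and "cubic G"
    and "flow_admissible G \<sigma>"
    and "\<not> has_long_barbell G \<sigma>"
  shows "admits_nowhere_zero_mod_flow G \<sigma> 4 \<longleftrightarrow> edge_colorable G 3"
  using colorable_if_mod_4_flow[OF assms(1,2,4)] mod_4_flow_if_colorable[OF assms(1,2,4)] by blast

end
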